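(* Consider the problems $\max\{f(S) : |S| = p/q \cdot n\}$ and $\max\{f(S) : |S| \leq p/q \cdot n\}$, where $p < q$ are positive constant integers and $f\colon 2^\mathcal{N} \to \mathbb{R}^+$ is a non-negative symmetric submodular function with $n = |\mathcal{N}|$ obeying $n/q \in \mathbb{Z}$. Then, for any constant $\varepsilon > 0$, every algorithm achieving an approximation ratio of $1/2 + \varepsilon$ for either of these two problems must use an exponential number of value oracle queries.
   Context: A set function $f\colon 2^\mathcal{N} \to \mathbb{R}^+$ is symmetric if $f(S) = f(\mathcal{N}\setminus S)$ for every $S \subseteq \mathcal{N}$, and submodular if $f(A)+f(B) \geq f(A\cup B)+f(A\cap B)$ for all $A,B \subseteq \mathcal{N}$. The function $f$ is accessed only through a value oracle, which given a set $S \subseteq \mathcal{N}$ returns $f(S)$. *)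

theory Defs
  imports "HOL-Probability.Probability"
begin

definition nonneg_on :: "'a set \<Rightarrow> ('a set \<Rightarrow> real) \<Rightarrow> bool" where
  "nonneg_on N f \<longleftrightarrow> (\<forall>S\<subseteq>N. 0 \<le> f S)"

definition symmetric_on :: "'a set \<Rightarrow> ('a set \<Rightarrow> real) \<Rightarrow> bool" where
  "symmetric_on N f \<longleftrightarrow> (\<forall>S\<subseteq>N. f S = f (N - S))"

definition submodular_on :: "'a set \<Rightarrow> ('a set \<Rightarrow> real) \<Rightarrow> bool" where
  "submodular_on N f \<longleftrightarrow> (\<forall>A\<subseteq>N. \<forall>B\<subseteq>N. f A + f B \<ge> f (A \<union> B) + f (A \<inter> B))"

definition sym_submod :: "'a set \<Rightarrow> ('a set \<Rightarrow> real) \<Rightarrow> bool" where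
  "sym_submod N f \<longleftrightarrow> nonneg_on N f \<and> symmetric_on N f \<and> submodular_on N f"

definition card_eq_family :: "nat \<Rightarrow> nat \<Rightarrow> 'a set \<Rightarrow> 'a set set" where
  "card_eq_family p q N = {S. S \<subseteq> N \<and> real (card S) = real p / real q * real (card N)}"

definition card_le_family :: "nat \<Rightarrow> nat \<Rightarrow> 'a set \<Rightarrow> 'a set set" where
  "card_le_family p q N = {S. S \<subseteq> N \<and> real (card S) \<le> real p / real q * real (card N)}"

text \<open>A deterministic value oracle algorithm is an adaptive query strategy: it either stops with
  an output set, or queries a set and continues depending on the oracle's answer. No bound is put
  on the computation done between queries.\<close>

datatype 'a strategy =
    Output "'a set"
  | Query "'a set" "real \<Rightarrow> 'a strategy"

primrec queries :: "('a set \<Rightarrow> real) \<Rightarrow> 'a strategy \<Rightarrow> 'a set list" where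
  "queries f (Output S) = []"
| "queries f (Query S k) = S # queries f (k (f S))"

primrec result :: "('a set \<Rightarrow> real) \<Rightarrow> 'a strategy \<Rightarrow> 'a set" where
  "result f (Output S) = S"
| "result f (Query S k) = result f (k (f S))"

text \<open>A (possibly randomized) algorithm draws a seed from a probability space M and then follows
  the strategy selected by the seed; deterministic algorithms are the constant families. Only
  subsets of the ground set may be submitted to the oracle, and since an algorithm sees f only
  through its answers, values of f outside the subsets of N play no role.\<close>

definition oracle_algorithm ::
  "'a set \<Rightarrow> 'w measure \<Rightarrow> ('w \<Rightarrow> 'a strategy) \<Rightarrow> bool" where
  "oracle_algorithm N M A \<longleftrightarrow> prob_space M \<and>
     (\<forall>f. sym_submod N f \<longrightarrow>
        (\<lambda>\<omega>. queries f (A \<omega>)) \<in> M \<rightarrow>\<^sub>M count_space UNIV \<and>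
        (\<lambda>\<omega>. result f (A \<omega>)) \<in> M \<rightarrow>\<^sub>M count_space UNIV \<and>
        (\<forall>\<omega>\<in>space M. set (queries f (A \<omega>)) \<subseteq> Pow N))"

definition achieves_ratio ::
  "real \<Rightarrow> 'a set \<Rightarrow> 'a set set \<Rightarrow> 'w measure \<Rightarrow> ('w \<Rightarrow> 'a strategy) \<Rightarrow> bool" where
  "achieves_ratio \<alpha> N \<F> M A \<longleftrightarrow>
     (\<forall>f. sym_submod N f \<longrightarrow>
        (AE \<omega> in M. result f (A \<omega>) \<in> \<F>) \<and>
        (\<integral>\<omega>. f (result f (A \<omega>)) \<partial>M) \<ge> \<alpha> * Max (f ` \<F>))"

text \<open>The expectation is at most the worst-case number of queries over all seeds (and equals the
  number of queries of a deterministic algorithm), so lower bounds on it also bound the latter.\<close>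

definition expected_queries ::
  "'w measure \<Rightarrow> ('w \<Rightarrow> 'a strategy) \<Rightarrow> ('a set \<Rightarrow> real) \<Rightarrow> ennreal" where
  "expected_queries M A f = (\<integral>\<^sup>+\<omega>. of_nat (length (queries f (A \<omega>))) \<partial>M)"

end

theory Submission
  imports Defs "HOL-Real_Asymp.Real_Asymp"
begin

text \<open>
  Fix \<open>U \<subseteq> N\<close> with \<open>|U| = 2k\<close>, where \<open>k = min p (q - p) \<cdot> n / q\<close>, and hide a random half \<open>H\<close> of \<open>U\<close>. For
  \<open>m = |S \<inter> U|\<close> and \<open>d = |S \<inter> H| - |S \<inter> (U - H)|\<close>, twice the cut function of the complete bipartite
  graph between \<open>H\<close> and \<open>U - H\<close> is \<open>m (2k - m) + d\<^sup>2\<close>. Replacing \<open>d\<^sup>2\<close> by \<open>(max 0 (|d| - \<delta>k))\<^sup>2\<close> keeps the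
  function symmetric and submodular, but makes it equal to \<open>m (2k - m)\<close>, which carries no information
  on \<open>H\<close> and is at most \<open>k\<^sup>2\<close>, on every set that \<open>H\<close> splits almost evenly. A feasible set meeting \<open>U\<close> in
  exactly \<open>H\<close> has value close to \<open>2k\<^sup>2\<close>. An exponential moment bound shows that a fixed set is split
  unevenly with exponentially small probability, so an algorithm run on \<open>m (2k - m)\<close> with fewer than
  exponentially many queries misses some \<open>H\<close> with probability close to 1; on the function hiding this
  \<open>H\<close> it returns the same set, of value at most \<open>k\<^sup>2\<close>.
\<close>

section \<open>Squared distance to an interval and its convexity\<close>

definition clip :: "real \<Rightarrow> real \<Rightarrow> real" where
  "clip D x = max (- D) (min D x)"

text \<open>For \<open>0 \<le> D\<close> this is the squared distance from \<open>x\<close> to the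
  interval from \<open>- D\<close> to \<open>D\<close>, with \<open>clip D x\<close> the nearest
  point. Writing it through the projection makes both subgradients used below explicit.\<close>

definition dead_zone_sq :: "real \<Rightarrow> real \<Rightarrow> real" where
  "dead_zone_sq D x = (x - clip D x)\<^sup>2"

lemma clip_mono: "x \<le> y \<Longrightarrow> clip D x \<le> clip D y"
  by (auto simp: clip_def)

lemma clip_residual_mono: "x \<le> y \<Longrightarrow> x - clip D x \<le> y - clip D y"
  by (auto simp: clip_def max_def min_def)

lemma clip_minus: "0 \<le> D \<Longrightarrow> clip D (- x) = - clip D x"
  by (auto simp: clip_def max_def min_def)

lemma dead_zone_sq_eq_0: "\<bar>x\<bar> \<le> D \<Longrightarrow> dead_zone_sq D x = 0"
  by (auto simp: dead_zone_sq_def clip_def max_def min_def)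

lemma dead_zone_sq_eq: "0 \<le> D \<Longrightarrow> D \<le> x \<Longrightarrow> dead_zone_sq D x = (x - D)\<^sup>2"
  by (auto simp: dead_zone_sq_def clip_def max_def min_def)

lemma dead_zone_sq_minus: "0 \<le> D \<Longrightarrow> dead_zone_sq D (- x) = dead_zone_sq D x"
  by (simp add: dead_zone_sq_def clip_minus power2_eq_square algebra_simps)

lemma dead_zone_sq_le: "0 \<le> D \<Longrightarrow> dead_zone_sq D x \<le> x\<^sup>2"
  unfolding dead_zone_sq_def
  by (rule power2_le_iff_abs_le[THEN iffD2, OF abs_ge_zero, of _ x, simplified])
     (auto simp: clip_def max_def min_def abs_if)

text \<open>The projection is a nearest point of the interval, so no other \<open>y\<close> in the
  interval is closer to \<open>x\<close>.\<close>

lemma dead_zone_sq_le_dist: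
  assumes "\<bar>y\<bar> \<le> D"
  shows "dead_zone_sq D x \<le> (x - y)\<^sup>2"
proof -
  have "\<bar>x - clip D x\<bar> \<le> \<bar>x - y\<bar>"
    using assms by (auto simp: clip_def max_def min_def)
  then show ?thesis
    unfolding dead_zone_sq_def by (metis abs_le_square_iff)
qed

lemma dead_zone_sq_subgradient:
  assumes "0 \<le> D"
  shows "dead_zone_sq D z + 2 * (z - clip D z) * (w - z) \<le> dead_zone_sq D w"
proof -
  define e v where "e = z - clip D z" and "v = w - clip D w"
  \<comment> \<open>Obtuse angle property of a projection: a nonzero residual \<open>e\<close> puts
    \<open>clip D z\<close> at the endpoint towards which \<open>e\<close> points, and
    \<open>clip D w\<close> cannot lie beyond it.\<close>
  have "e * (clip D w - clip D z) \<le> 0"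
  proof (cases "e = 0")
    case False
    then have "(0 < e \<and> clip D z = D) \<or> (e < 0 \<and> clip D z = - D)"
      using assms by (auto simp: e_def clip_def max_def min_def split: if_splits)
    moreover have "- D \<le> clip D w" "clip D w \<le> D"
      using assms by (auto simp: clip_def)
    ultimately show ?thesis
      by (auto intro: mult_nonneg_nonpos mult_nonpos_nonneg)
  qed simp
  moreover have "0 \<le> (v - e)\<^sup>2" by simp
  moreover have "2 * e * (w - z) = 2 * e * (v - e) + 2 * (e * (clip D w - clip D z))"
    by (simp add: e_def v_def algebra_simps)
  ultimately have "e\<^sup>2 + 2 * e * (w - z) \<le> v\<^sup>2"
    by (simp add: power2_eq_square algebra_simps)
  then show ?thesis by (simp add: dead_zone_sq_def e_def v_def)
qed

text \<open>The function \<open>x\<^sup>2 - dead_zone_sq D x\<close> is the maximum of the affine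
  functions \<open>2 * x * y - y\<^sup>2\<close> over \<open>y\<close> in the interval, attained at
  \<open>y = clip D x\<close>; the maximiser at \<open>z\<close> supplies the slope
  \<open>2 * clip D z\<close>.\<close>

lemma dead_zone_sq_co_subgradient:
  assumes "0 \<le> D"
  shows "z\<^sup>2 - dead_zone_sq D z + 2 * clip D z * (w - z) \<le> w\<^sup>2 - dead_zone_sq D w"
proof -
  have "\<bar>clip D z\<bar> \<le> D" using assms by (auto simp: clip_def)
  from dead_zone_sq_le_dist[OF this, of w] show ?thesis
    by (simp add: dead_zone_sq_def power2_eq_square algebra_simps)
qed

text \<open>The subgradient inequalities from \<open>x + a\<close> to \<open>x\<close> and from
  \<open>x + b\<close> to \<open>x + a + b\<close> add up to a gain of
  \<open>a * (r (x + b) - r (x + a))\<close>, nonnegative by monotonicity if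
  \<open>a \<le> b\<close>; the other case is symmetric.\<close>

lemma second_difference_nonneg:
  fixes \<phi> r :: "real \<Rightarrow> real"
  assumes sub: "\<And>z w. \<phi> z + r z * (w - z) \<le> \<phi> w"
    and mono: "\<And>z w. z \<le> w \<Longrightarrow> r z \<le> r w"
    and "0 \<le> a" "0 \<le> b"
  shows "\<phi> (x + a) + \<phi> (x + b) \<le> \<phi> (x + a + b) + \<phi> x"
proof -
  have *: "\<phi> (x + a) + \<phi> (x + b) \<le> \<phi> (x + a + b) + \<phi> x" if "0 \<le> a" "a \<le> b" for a b
  proof -
    have "r (x + a) \<le> r (x + b)" using mono that by simp
    then have "a * r (x + a) \<le> a * r (x + b)" using that by (simp add: mult_left_mono)
    then show ?thesis
      using sub[of "x + a" x] sub[of "x + b" "x + a + b"] by (simp add: algebra_simps)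
  qed
  show ?thesis
    using *[of a b] *[of b a] assms(3,4) by (cases "a \<le> b") (simp_all add: algebra_simps)
qed

text \<open>Both \<open>\<phi>\<close> and \<open>x\<^sup>2 - \<phi>\<close> are convex for \<open>\<phi> = dead_zone_sq D\<close>: the first gives the bound when
  \<open>a\<close> and \<open>b\<close> have opposite signs, the second when they have the same sign.\<close>

lemma dead_zone_sq_second_difference:
  assumes D: "0 \<le> D"
  shows "dead_zone_sq D (x + a + b) + dead_zone_sq D x
       \<le> dead_zone_sq D (x + a) + dead_zone_sq D (x + b) + 2 * \<bar>a\<bar> * \<bar>b\<bar>"
proof -
  let ?\<phi> = "dead_zone_sq D"
  have conv: "?\<phi> (x + a) + ?\<phi> (x + b) \<le> ?\<phi> (x + a + b) + ?\<phi> x" if "0 \<le> a" "0 \<le> b" for x a b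
    by (rule second_difference_nonneg[where r = "\<lambda>z. 2 * (z - clip D z)"])
       (use D that dead_zone_sq_subgradient clip_residual_mono in
         \<open>auto simp del: right_diff_distrib_numeral\<close>)
  have coconv: "((x + a)\<^sup>2 - ?\<phi> (x + a)) + ((x + b)\<^sup>2 - ?\<phi> (x + b))
      \<le> ((x + a + b)\<^sup>2 - ?\<phi> (x + a + b)) + (x\<^sup>2 - ?\<phi> x)" if "0 \<le> a" "0 \<le> b" for x a b
    by (rule second_difference_nonneg[where \<phi> = "\<lambda>x. x\<^sup>2 - ?\<phi> x" and r = "\<lambda>z. 2 * clip D z"])
       (use D that dead_zone_sq_co_subgradient clip_mono in auto)
  have same: "?\<phi> (x + a + b) + ?\<phi> x \<le> ?\<phi> (x + a) + ?\<phi> (x + b) + 2 * a * b"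
    if "0 \<le> a" "0 \<le> b" for x a b
    using coconv[OF that, of x] by (simp add: power2_eq_square algebra_simps)
  consider "0 \<le> a" "0 \<le> b" | "a \<le> 0" "b \<le> 0" | "0 \<le> a" "b \<le> 0" | "a \<le> 0" "0 \<le> b"
    by linarith
  then show ?thesis
  proof cases
    case 1
    then show ?thesis using same by simp
  next
    case 2
    \<comment> \<open>Reading the four points from the other end turns both increments
      nonnegative.\<close>
    then show ?thesis using same[of "- a" "- b" "x + a + b"] by (simp add: algebra_simps)
  next
    case 3
    \<comment> \<open>Now \<open>x\<close> and \<open>x + a + b\<close> lie between
      \<open>x + b\<close> and \<open>x + a\<close>, so convexity alone gives the bound and the
      product term is slack.\<close>
    have "0 \<le> \<bar>a\<bar> * \<bar>b\<bar>" by simp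
    with 3 show ?thesis
      using conv[of a "- b" "x + b"] by (simp add: algebra_simps)
  next
    case 4
    have "0 \<le> \<bar>a\<bar> * \<bar>b\<bar>" by simp
    with 4 show ?thesis
      using conv[of "- a" b "x + a"] by (simp add: algebra_simps)
  qed
qed

section \<open>Symmetry and submodularity of the hidden cut\<close>

definition imbalance :: "'a set \<Rightarrow> 'a set \<Rightarrow> 'a set \<Rightarrow> real" where
  "imbalance U A S = real (card (S \<inter> A)) - real (card (S \<inter> (U - A)))"

definition hidden_cut :: "'a set \<Rightarrow> 'a set \<Rightarrow> real \<Rightarrow> 'a set \<Rightarrow> real" where
  "hidden_cut U A D S =
     real (card (S \<inter> U)) * (real (card U) - real (card (S \<inter> U))) + dead_zone_sq D (imbalance U A S)"

lemma card_Int_split: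
  assumes "finite U" "A \<subseteq> U"
  shows "card (S \<inter> U) = card (S \<inter> A) + card (S \<inter> (U - A))"
proof -
  have "S \<inter> U = (S \<inter> A) \<union> (S \<inter> (U - A))" using assms by auto
  then show ?thesis
    using assms by (metis Diff_disjoint Int_assoc Int_left_commute card_Un_disjoint finite_Diff
        finite_Int finite_subset inf_bot_right)
qed

lemma abs_imbalance_le:
  assumes "finite U" "A \<subseteq> U"
  shows "\<bar>imbalance U A S\<bar> \<le> real (card (S \<inter> U))"
  using card_Int_split[OF assms, of S] by (auto simp: imbalance_def)

lemma abs_imbalance_le_half:
  assumes "finite U" "A \<subseteq> U" "card U = 2 * card A"
  shows "\<bar>imbalance U A S\<bar> \<le> real (card A)"
proof -
  have "card (S \<inter> A) \<le> card A" "card (S \<inter> (U - A)) \<le> card (U - A)"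
    using assms by (auto intro!: card_mono finite_subset[of A U])
  moreover have "card (U - A) = card A"
    using assms by (simp add: card_Diff_subset finite_subset)
  ultimately show ?thesis by (auto simp: imbalance_def)
qed

lemma card_Int_diff_split:
  assumes "finite V"
  shows "card (X \<inter> V) = card (X \<inter> Y \<inter> V) + card ((X - Y) \<inter> V)"
proof -
  have "X \<inter> V = (X \<inter> Y \<inter> V) \<union> ((X - Y) \<inter> V)" by auto
  then show ?thesis using assms by (metis (no_types, lifting) card_Un_disjoint finite_Int
        Diff_Diff_Int Diff_disjoint Int_Diff Int_assoc Int_commute disjoint_iff DiffE IntE)
qed

lemma card_Un_Int_split:
  assumes "finite V"
  shows "card ((X \<union> Y) \<inter> V) = card (X \<inter> Y \<inter> V) + card ((X - Y) \<inter> V) + card ((Y - X) \<inter> V)"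
proof -
  have "((X \<union> Y) \<inter> V) \<inter> X = X \<inter> V" "(X \<union> Y) \<inter> V - X = (Y - X) \<inter> V" by auto
  then have "card ((X \<union> Y) \<inter> V) = card (X \<inter> V) + card ((Y - X) \<inter> V)"
    using assms card_Int_Diff[of "(X \<union> Y) \<inter> V" X] by simp
  then show ?thesis using card_Int_diff_split[OF assms, of X Y] by simp
qed

text \<open>Both m and d are additive over the disjoint pieces \<open>X \<inter> Y\<close>,
  \<open>X - Y\<close> and \<open>Y - X\<close>. The concave term in m leaves a surplus of twice the
  product of m on the two differences; the dead zone term costs at most twice the product of the
  values of |d| there, and |d| is at most m.\<close>

lemma submodular_hidden_cut:
  fixes U :: "'a set"
  assumes "finite U" "A \<subseteq> U" "0 \<le> D"
  shows "submodular_on N (hidden_cut U A D)"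
  unfolding submodular_on_def
proof (intro allI impI)
  fix X Y :: "'a set"
  let ?m = "\<lambda>S. real (card (S \<inter> U))" and ?d = "imbalance U A"
  have fin: "finite U" "finite A" "finite (U - A)" using assms finite_subset by auto
  have split: "real (card (X \<inter> V)) = card (X \<inter> Y \<inter> V) + card ((X - Y) \<inter> V)"
    "real (card (Y \<inter> V)) = card (X \<inter> Y \<inter> V) + card ((Y - X) \<inter> V)"
    "real (card ((X \<union> Y) \<inter> V)) = card (X \<inter> Y \<inter> V) + card ((X - Y) \<inter> V) + card ((Y - X) \<inter> V)"
    if "finite V" for V
    using card_Int_diff_split[OF that, of X Y] card_Int_diff_split[OF that, of Y X]
      card_Un_Int_split[OF that, of X Y] by (simp_all only: Int_commute[of Y X] of_nat_add)
  have m: "?m X = ?m (X \<inter> Y) + ?m (X - Y)" "?m Y = ?m (X \<inter> Y) + ?m (Y - X)"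
    "?m (X \<union> Y) = ?m (X \<inter> Y) + ?m (X - Y) + ?m (Y - X)"
    using split[OF fin(1)] by simp_all
  have d: "?d X = ?d (X \<inter> Y) + ?d (X - Y)" "?d Y = ?d (X \<inter> Y) + ?d (Y - X)"
    "?d (X \<union> Y) = ?d (X \<inter> Y) + ?d (X - Y) + ?d (Y - X)"
    unfolding imbalance_def using split[OF fin(2)] split[OF fin(3)] by simp_all
  have "\<bar>?d (X - Y)\<bar> * \<bar>?d (Y - X)\<bar> \<le> ?m (X - Y) * ?m (Y - X)"
    using abs_imbalance_le assms by (intro mult_mono) auto
  moreover note dead_zone_sq_second_difference[OF assms(3), of "?d (X \<inter> Y)" "?d (X - Y)" "?d (Y - X)"]
  ultimately show "hidden_cut U A D (X \<union> Y) + hidden_cut U A D (X \<inter> Y)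
      \<le> hidden_cut U A D X + hidden_cut U A D Y"
    unfolding hidden_cut_def m d by (simp add: algebra_simps)
qed

text \<open>Complementation in \<open>N\<close> sends m to \<open>card U\<close> minus m and,
  because \<open>A\<close> and \<open>U - A\<close> have equal size, d to its negative.\<close>

lemma sym_submod_hidden_cut:
  assumes "finite N" "U \<subseteq> N" "A \<subseteq> U" "card U = 2 * card A" "0 \<le> D"
  shows "sym_submod N (hidden_cut U A D)"
  unfolding sym_submod_def
proof (intro conjI)
  have fin: "finite U" "finite A"
    using assms finite_subset[of U N] finite_subset[of A U] by auto
  show "nonneg_on N (hidden_cut U A D)"
    unfolding nonneg_on_def hidden_cut_def dead_zone_sq_def
    using fin by (auto intro!: add_nonneg_nonneg mult_nonneg_nonneg card_mono)
  show "submodular_on N (hidden_cut U A D)"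
    using submodular_hidden_cut assms fin by blast
  have "hidden_cut U A D (N - S) = hidden_cut U A D S" for S
  proof -
    have compl: "real (card ((N - S) \<inter> V)) = real (card V) - real (card (S \<inter> V))" if "V \<subseteq> U" for V
    proof -
      have "finite V" "V \<inter> S = S \<inter> V" "V - S = (N - S) \<inter> V"
        using that assms fin finite_subset by auto
      then show ?thesis using card_Int_Diff[of V S] by simp
    qed
    have "card (U - A) = card A"
      using assms fin by (simp add: card_Diff_subset)
    then have "imbalance U A (N - S) = - imbalance U A S"
      unfolding imbalance_def using assms by (simp add: compl)
    then show ?thesis
      unfolding hidden_cut_def using assms by (simp add: compl dead_zone_sq_minus)
  qed
  then show "symmetric_on N (hidden_cut U A D)"
    by (simp add: symmetric_on_def)
qed

section \<open>Equal answers give equal runs\<close>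

lemma strategy_indistinguishable:
  assumes "\<forall>S\<in>set (queries f s). g S = f S"
  shows "queries g s = queries f s \<and> result g s = result f s"
  using assms by (induction s) auto

section \<open>Exponential moments of the imbalance and averaging over hidden sets\<close>

lemma exp_plus_exp_minus_le:
  fixes h :: real
  assumes "0 \<le> h" "h \<le> 1"
  shows "exp h + exp (- h) \<le> 2 * exp (h\<^sup>2)"
proof -
  have "exp h \<le> 1 + h + h\<^sup>2" using assms by (rule exp_bound)
  moreover have "exp (- h) \<le> 1 - h + h\<^sup>2"
  proof -
    \<comment> \<open>The product is exactly \<open>1 + h ^ 3\<close>.\<close>
    have "1 \<le> (1 - h + h\<^sup>2) * (1 + h)"
      using assms by (simp add: algebra_simps power2_eq_square)
    also have "\<dots> \<le> (1 - h + h\<^sup>2) * exp h"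
      using assms by (intro mult_left_mono exp_ge_add_one_self) (auto intro: add_nonneg_nonneg)
    finally show ?thesis by (simp add: exp_minus field_simps)
  qed
  moreover have "1 + h\<^sup>2 \<le> exp (h\<^sup>2)" by (rule exp_ge_add_one_self)
  ultimately show ?thesis by linarith
qed

text \<open>Up to normalisation this is the moment generating function of the imbalance for a
  uniformly random subset \<open>A\<close>. Summing over all subsets rather than halves makes the
  signs of the elements independent, so the sum factorises over \<open>U\<close>.\<close>

lemma sum_exp_imbalance_le:
  fixes h :: real
  assumes U: "finite U" and h: "\<bar>h\<bar> \<le> 1"
  shows "(\<Sum>A\<in>Pow U. exp (h * imbalance U A S)) \<le> (2 * exp (h\<^sup>2)) ^ card U"
proof -
  let ?w = "\<lambda>i. indicator S i :: real"
  have "(\<Sum>A\<in>Pow U. exp (h * imbalance U A S))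
      = (\<Sum>A\<in>Pow U. (\<Prod>i\<in>A. exp (h * ?w i)) * (\<Prod>i\<in>U - A. exp (- h * ?w i)))"
  proof (rule sum.cong)
    fix A assume "A \<in> Pow U"
    then have fin: "finite A" using U finite_subset by auto
    have imb: "imbalance U A S = (\<Sum>i\<in>A. ?w i) - (\<Sum>i\<in>U - A. ?w i)"
      unfolding imbalance_def using fin U by (simp add: indicator_def sum_of_bool_eq Int_commute)
    show "exp (h * imbalance U A S)
        = (\<Prod>i\<in>A. exp (h * ?w i)) * (\<Prod>i\<in>U - A. exp (- h * ?w i))"
      unfolding imb using fin U by (simp add: exp_sum[symmetric] sum_distrib_left[symmetric] exp_add[symmetric]
          sum_negf algebra_simps)
  qed simp
  also have "\<dots> = (\<Prod>i\<in>U. exp (h * ?w i) + exp (- h * ?w i))"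
    using U by (simp add: prod_add)
  also have "\<dots> \<le> (\<Prod>i\<in>U. 2 * exp (h\<^sup>2))"
  proof (rule prod_mono)
    fix i assume "i \<in> U"
    have "exp h + exp (- h) \<le> 2 * exp (h\<^sup>2)"
      using exp_plus_exp_minus_le[of "\<bar>h\<bar>"] h by (cases "0 \<le> h") (auto simp: add.commute)
    then show "0 \<le> exp (h * ?w i) + exp (- h * ?w i) \<and>
        exp (h * ?w i) + exp (- h * ?w i) \<le> 2 * exp (h\<^sup>2)"
      by (cases "i \<in> S") (auto intro: add_nonneg_nonneg)
  qed
  finally show ?thesis by simp
qed

text \<open>Chernoff's method: Markov's inequality for the exponential moments at \<open>h\<close>
  and \<open>- h\<close>, one for each tail.\<close>

lemma card_unbalanced_le:
  fixes \<delta> :: real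
  assumes U: "finite U" "card U = 2 * k" and \<delta>: "0 \<le> \<delta>" "\<delta> \<le> 1"
  shows "real (card {A \<in> Pow U. \<delta> * k < \<bar>imbalance U A S\<bar>}) \<le> 2 * 4 ^ k * exp (- \<delta>\<^sup>2 * k / 8)"
proof -
  let ?B = "{A \<in> Pow U. \<delta> * k < \<bar>imbalance U A S\<bar>}"
  \<comment> \<open>This value minimises the final exponent
    \<open>2 * h\<^sup>2 * k - h * (\<delta> * k)\<close>.\<close>
  define h where "h = \<delta> / 4"
  have h: "0 \<le> h" "h \<le> 1" using \<delta> by (auto simp: h_def)
  let ?g = "\<lambda>A. exp (h * imbalance U A S) + exp (- h * imbalance U A S)"
  have "real (card ?B) * exp (h * (\<delta> * k)) = (\<Sum>A\<in>?B. exp (h * (\<delta> * k)))"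
    by simp
  also have "\<dots> \<le> (\<Sum>A\<in>?B. ?g A)"
  proof (rule sum_mono)
    fix A assume "A \<in> ?B"
    then have "h * (\<delta> * k) \<le> h * \<bar>imbalance U A S\<bar>"
      using h by (intro mult_left_mono) auto
    then have "exp (h * (\<delta> * k)) \<le> exp (h * \<bar>imbalance U A S\<bar>)" by simp
    also have "\<dots> \<le> ?g A" by (cases "0 \<le> imbalance U A S") auto
    finally show "exp (h * (\<delta> * k)) \<le> ?g A" .
  qed
  also have "\<dots> \<le> (\<Sum>A\<in>Pow U. ?g A)"
    using U by (intro sum_mono2) (auto intro: add_nonneg_nonneg)
  also have "\<dots> \<le> 2 * (2 * exp (h\<^sup>2)) ^ (2 * k)"
    using sum_exp_imbalance_le[OF U(1), of h S] sum_exp_imbalance_le[OF U(1), of "- h" S] h U(2)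
    by (simp add: sum.distrib)
  also have "\<dots> = 2 * ((2 * exp (h\<^sup>2))\<^sup>2) ^ k"
    by (simp only: power_mult)
  also have "(2 * exp (h\<^sup>2))\<^sup>2 = 4 * exp (2 * h\<^sup>2)"
    by (simp add: power_mult_distrib exp_double)
  also have "2 * (4 * exp (2 * h\<^sup>2)) ^ k = 2 * 4 ^ k * exp (2 * h\<^sup>2 * k)"
    by (simp add: power_mult_distrib exp_of_nat_mult[symmetric] mult_ac)
  finally have "real (card ?B) \<le> 2 * 4 ^ k * exp (2 * h\<^sup>2 * k) * exp (- (h * (\<delta> * k)))"
    by (simp add: exp_minus field_simps)
  also have "\<dots> = 2 * 4 ^ k * exp (2 * h\<^sup>2 * k - h * (\<delta> * k))"
    by (simp add: exp_diff exp_minus field_simps)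
  also have "2 * h\<^sup>2 * k - h * (\<delta> * k) = - \<delta>\<^sup>2 * k / 8"
    by (simp add: h_def power2_eq_square field_simps)
  finally show ?thesis .
qed

text \<open>Passing from all subsets to halves costs only a factor \<open>2 * k\<close>, since the
  central binomial coefficient is at least \<open>4 ^ k / (2 * k)\<close>.\<close>

lemma card_unbalanced_halves_le:
  fixes \<delta> :: real
  assumes U: "finite U" "card U = 2 * k" "0 < k" and \<delta>: "0 \<le> \<delta>" "\<delta> \<le> 1"
  shows "real (card {A. A \<subseteq> U \<and> card A = k \<and> \<delta> * k < \<bar>imbalance U A S\<bar>})
       \<le> 4 * real k * exp (- \<delta>\<^sup>2 * k / 8) * card {A. A \<subseteq> U \<and> card A = k}"
proof -
  have "real (card {A. A \<subseteq> U \<and> card A = k \<and> \<delta> * k < \<bar>imbalance U A S\<bar>})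
      \<le> real (card {A \<in> Pow U. \<delta> * k < \<bar>imbalance U A S\<bar>})"
    using U by (intro of_nat_mono card_mono) auto
  also have "\<dots> \<le> 2 * 4 ^ k * exp (- \<delta>\<^sup>2 * k / 8)"
    by (rule card_unbalanced_le[OF U(1,2) \<delta>])
  also have "4 ^ k \<le> 2 * k * real (card {A. A \<subseteq> U \<and> card A = k})"
    using central_binomial_lower_bound[OF U(3)] U by (simp add: n_subsets field_simps)
  finally show ?thesis by (simp add: algebra_simps)
qed

text \<open>A union bound combined with averaging. The list \<open>Q \<omega>\<close> does not
  depend on \<open>a\<close>, so for each seed the entries spoil at most
  \<open>\<eta> * card I\<close> indices apiece; after integration, some index does no worse than
  the average.\<close>

lemma exists_rarely_bad:
  fixes Q :: "'w \<Rightarrow> 'b list" and bad :: "'c \<Rightarrow> 'b \<Rightarrow> bool" and \<eta> :: real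
  assumes fin: "finite I" "I \<noteq> {}" and \<eta>: "0 \<le> \<eta>"
    and rare: "\<And>x. real (card {a \<in> I. bad a x}) \<le> \<eta> * card I"
    and meas_len: "(\<lambda>\<omega>. length (Q \<omega>)) \<in> M \<rightarrow>\<^sub>M count_space UNIV"
    and meas: "\<And>a. a \<in> I \<Longrightarrow> {\<omega> \<in> space M. \<exists>x\<in>set (Q \<omega>). bad a x} \<in> sets M"
  shows "\<exists>a\<in>I. emeasure M {\<omega> \<in> space M. \<exists>x\<in>set (Q \<omega>). bad a x}
           \<le> ennreal \<eta> * (\<integral>\<^sup>+\<omega>. of_nat (length (Q \<omega>)) \<partial>M)"
proof -
  define E where "E a = {\<omega> \<in> space M. \<exists>x\<in>set (Q \<omega>). bad a x}" for a
  define L where "L = (\<integral>\<^sup>+\<omega>. of_nat (length (Q \<omega>)) \<partial>M)"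
  have E: "E a \<in> sets M" if "a \<in> I" for a using meas that by (simp add: E_def)
  have len: "(\<lambda>\<omega>. of_nat (length (Q \<omega>)) :: ennreal) \<in> borel_measurable M"
    using measurable_compose[OF meas_len, of of_nat borel] by simp
  have pt: "(\<Sum>a\<in>I. indicator (E a) \<omega> :: ennreal) \<le> ennreal (\<eta> * card I) * of_nat (length (Q \<omega>))" for \<omega>
  proof -
    have "(\<Sum>a\<in>I. indicator (E a) \<omega> :: real) \<le> (\<Sum>a\<in>I. \<Sum>x\<leftarrow>Q \<omega>. of_bool (bad a x))"
    proof (rule sum_mono)
      fix a
      have "of_bool (\<exists>x\<in>set xs. bad a x) \<le> (\<Sum>x\<leftarrow>xs. of_bool (bad a x) :: real)" for xs
      proof (induction xs)
        case (Cons y ys)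
        have "0 \<le> (\<Sum>x\<leftarrow>ys. of_bool (bad a x) :: real)" by (induction ys) auto
        with Cons show ?case by (cases "bad a y") simp_all
      qed simp
      then show "indicator (E a) \<omega> \<le> (\<Sum>x\<leftarrow>Q \<omega>. of_bool (bad a x) :: real)"
        by (rule order_trans[rotated]) (auto simp: E_def indicator_def)
    qed
    also have "\<dots> = (\<Sum>x\<leftarrow>Q \<omega>. real (card {a \<in> I. bad a x}))"
    proof -
      have "(\<Sum>a\<in>I. \<Sum>x\<leftarrow>xs. of_bool (bad a x)) = (\<Sum>x\<leftarrow>xs. real (card {a \<in> I. bad a x}))" for xs
        using fin by (induction xs) (simp_all add: sum.distrib sum_of_bool_eq Int_def)
      then show ?thesis .
    qed
    also have "\<dots> \<le> (\<Sum>x\<leftarrow>Q \<omega>. \<eta> * card I)"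
      by (rule sum_list_mono) (rule rare)
    also have "\<dots> = \<eta> * card I * length (Q \<omega>)" by (simp add: sum_list_triv)
    finally have "ennreal (\<Sum>a\<in>I. indicator (E a) \<omega>) \<le> ennreal (\<eta> * card I * length (Q \<omega>))"
      by (rule ennreal_leI)
    then show ?thesis
      using \<eta> by (simp add: ennreal_mult ennreal_of_nat_eq_real_of_nat sum_ennreal[symmetric] ennreal_indicator)
  qed
  have "Min ((\<lambda>a. emeasure M (E a)) ` I) \<in> (\<lambda>a. emeasure M (E a)) ` I"
    using fin by (intro Min_in) auto
  then obtain a where a: "a \<in> I" "emeasure M (E a) = Min ((\<lambda>a. emeasure M (E a)) ` I)"
    by auto
  have "(\<Sum>b\<in>I. emeasure M (E a)) \<le> (\<Sum>a\<in>I. emeasure M (E a))"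
    using fin by (intro sum_mono) (simp add: a(2))
  also have "\<dots> = (\<integral>\<^sup>+\<omega>. (\<Sum>a\<in>I. indicator (E a) \<omega>) \<partial>M)"
    using E by (simp add: nn_integral_sum)
  also have "\<dots> \<le> (\<integral>\<^sup>+\<omega>. ennreal (\<eta> * card I) * of_nat (length (Q \<omega>)) \<partial>M)"
    by (intro nn_integral_mono pt)
  also have "\<dots> = ennreal (\<eta> * card I) * L"
    unfolding L_def by (rule nn_integral_cmult[OF len])
  also have "\<dots> = of_nat (card I) * (ennreal \<eta> * L)"
    using \<eta> by (simp add: ennreal_mult ennreal_of_nat_eq_real_of_nat mult_ac)
  finally have "of_nat (card I) * emeasure M (E a) \<le> of_nat (card I) * (ennreal \<eta> * L)"
    by simp
  then have "emeasure M (E a) \<le> ennreal \<eta> * L"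
    using fin by (subst (asm) ennreal_mult_le_mult_iff) (auto simp: card_eq_0_iff)
  then show ?thesis using a(1) by (auto simp: E_def L_def)
qed

section \<open>The fooling cut and its optimum\<close>

definition balanced_cut :: "'a set \<Rightarrow> 'a set \<Rightarrow> real" where
  "balanced_cut U S = real (card (S \<inter> U)) * (real (card U) - real (card (S \<inter> U)))"

lemma hidden_cut_eq_balanced_cut:
  "\<bar>imbalance U A S\<bar> \<le> D \<Longrightarrow> hidden_cut U A D S = balanced_cut U S"
  by (simp add: hidden_cut_def balanced_cut_def dead_zone_sq_eq_0)

lemma balanced_cut_le:
  assumes "card U = 2 * k"
  shows "balanced_cut U S \<le> (real k)\<^sup>2"
proof -
  have "0 \<le> (real k - real (card (S \<inter> U)))\<^sup>2" by simp
  then show ?thesis using assms by (simp add: balanced_cut_def power2_eq_square algebra_simps)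
qed

text \<open>Each summand is at most the square of \<open>card A\<close>. This caps the value
  obtained on the rare seeds for which the hidden half is detected.\<close>

lemma hidden_cut_le:
  assumes "finite U" "A \<subseteq> U" "card U = 2 * card A" "0 \<le> D"
  shows "hidden_cut U A D S \<le> 2 * (real (card A))\<^sup>2"
proof -
  have "dead_zone_sq D (imbalance U A S) \<le> (imbalance U A S)\<^sup>2"
    using assms by (intro dead_zone_sq_le)
  also have "\<dots> \<le> (real (card A))\<^sup>2"
    using abs_imbalance_le_half[OF assms(1-3), of S] by (simp add: abs_le_square_iff[symmetric])
  finally show ?thesis
    using balanced_cut_le[OF assms(3), of S] by (simp add: hidden_cut_def balanced_cut_def)
qed

text \<open>With threshold \<open>k\<close> the dead zone contains every possible imbalance, so this
  is itself a hidden cut.\<close>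

lemma sym_submod_balanced_cut:
  assumes "finite N" "U \<subseteq> N" "card U = 2 * k"
  shows "sym_submod N (balanced_cut U)"
proof -
  obtain A where A: "A \<subseteq> U" "card A = k"
    using assms obtain_subset_with_card_n[of k U] by auto
  have "hidden_cut U A k = balanced_cut U"
    using abs_imbalance_le_half[of U A] assms A finite_subset[of U N]
    by (auto intro!: ext hidden_cut_eq_balanced_cut)
  then show ?thesis using sym_submod_hidden_cut[of N U A k] assms A by simp
qed

text \<open>All randomness is analysed on the run against \<open>balanced_cut U\<close>, which is
  independent of \<open>H\<close>. Outside the bad event the run against the hidden cut is the same
  and ends with a value at most k^2; on the bad event the value is at most 2 k^2.\<close>

lemma exists_fooling_hidden_cut:
  fixes U :: "'a set" and \<delta> L :: real
  assumes N: "finite N" "U \<subseteq> N" "card U = 2 * k" "0 < k" and \<delta>: "0 \<le> \<delta>" "\<delta> \<le> 1"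
    and alg: "oracle_algorithm N M A"
    and L: "0 \<le> L" "expected_queries M A (balanced_cut U) \<le> ennreal L"
  obtains H where "H \<subseteq> U" "card H = k"
    "(\<integral>\<omega>. hidden_cut U H (\<delta> * k) (result (hidden_cut U H (\<delta> * k)) (A \<omega>)) \<partial>M)
       \<le> (real k)\<^sup>2 * (1 + 4 * real k * exp (- \<delta>\<^sup>2 * k / 8) * (L + 1))"
proof -
  let ?f = "balanced_cut U"
  define I where "I = {H. H \<subseteq> U \<and> card H = k}"
  define \<eta> where "\<eta> = 4 * real k * exp (- \<delta>\<^sup>2 * k / 8)"
  define bad where "bad H S \<longleftrightarrow> \<delta> * k < \<bar>imbalance U H S\<bar>" for H S
  \<comment> \<open>The output is treated as one more query, because its value must agree under both
    functions too; hence \<open>L + 1\<close>.\<close>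
  define Q where "Q \<omega> = result ?f (A \<omega>) # queries ?f (A \<omega>)" for \<omega>
  have finU: "finite U" using N finite_subset by blast
  have \<eta>: "0 \<le> \<eta>" by (simp add: \<eta>_def)
  interpret prob_space M using alg by (simp add: oracle_algorithm_def)
  have query_meas: "(\<lambda>\<omega>. queries ?f (A \<omega>)) \<in> M \<rightarrow>\<^sub>M count_space UNIV"
    and res_meas: "(\<lambda>\<omega>. result ?f (A \<omega>)) \<in> M \<rightarrow>\<^sub>M count_space UNIV"
    using alg sym_submod_balanced_cut[OF N(1-3)] by (auto simp: oracle_algorithm_def)
  have len: "(\<lambda>\<omega>. of_nat (length (queries ?f (A \<omega>))) :: ennreal) \<in> borel_measurable M"
    using measurable_compose[OF query_meas, of "\<lambda>xs. of_nat (length xs)" borel] by simp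
  have sets: "{\<omega> \<in> space M. \<exists>S\<in>set (Q \<omega>). bad H S} \<in> sets M" for H
  proof -
    have "{\<omega> \<in> space M. bad H (result ?f (A \<omega>))} \<in> sets M"
      "{\<omega> \<in> space M. \<exists>S\<in>set (queries ?f (A \<omega>)). bad H S} \<in> sets M"
      using measurable_sets[OF res_meas, of "Collect (bad H)"]
        measurable_sets[OF query_meas, of "{xs. \<exists>S\<in>set xs. bad H S}"]
      by (simp_all add: vimage_def Int_def conj_commute)
    then have "{\<omega> \<in> space M. bad H (result ?f (A \<omega>))} \<union>
        {\<omega> \<in> space M. \<exists>S\<in>set (queries ?f (A \<omega>)). bad H S} \<in> sets M"
      by (rule sets.Un)
    also have "{\<omega> \<in> space M. bad H (result ?f (A \<omega>))} \<union>
        {\<omega> \<in> space M. \<exists>S\<in>set (queries ?f (A \<omega>)). bad H S}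
        = {\<omega> \<in> space M. \<exists>S\<in>set (Q \<omega>). bad H S}"
      by (auto simp: Q_def)
    finally show ?thesis .
  qed
  have "\<exists>H\<in>I. emeasure M {\<omega> \<in> space M. \<exists>S\<in>set (Q \<omega>). bad H S}
      \<le> ennreal \<eta> * (\<integral>\<^sup>+\<omega>. of_nat (length (Q \<omega>)) \<partial>M)"
  proof (rule exists_rarely_bad)
    show "finite I" using finU by (simp add: I_def)
    show "I \<noteq> {}" using N obtain_subset_with_card_n[of k U] by (auto simp: I_def)
    show "real (card {H \<in> I. bad H S}) \<le> \<eta> * card I" for S
      using card_unbalanced_halves_le[OF finU N(3,4) \<delta>, of S]
      by (simp add: I_def bad_def \<eta>_def conj_assoc)
    show "(\<lambda>\<omega>. length (Q \<omega>)) \<in> M \<rightarrow>\<^sub>M count_space UNIV"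
      using measurable_compose[OF query_meas, of "\<lambda>xs. Suc (length xs)"] by (simp add: Q_def)
  qed (use \<eta> sets in auto)
  then obtain H where H: "H \<subseteq> U" "card H = k" and
    "emeasure M {\<omega> \<in> space M. \<exists>S\<in>set (Q \<omega>). bad H S}
      \<le> ennreal \<eta> * (\<integral>\<^sup>+\<omega>. of_nat (length (Q \<omega>)) \<partial>M)"
    by (auto simp: I_def)
  note this(3)
  also have "(\<integral>\<^sup>+\<omega>. of_nat (length (Q \<omega>)) \<partial>M) = 1 + expected_queries M A ?f"
    using len by (simp add: Q_def expected_queries_def nn_integral_add emeasure_space_1)
  also have "ennreal \<eta> * (1 + expected_queries M A ?f) \<le> ennreal \<eta> * (1 + ennreal L)"
    using L by (intro mult_left_mono add_mono) auto
  also have "\<dots> = ennreal (\<eta> * (L + 1))"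
    using L \<eta> by (simp add: ennreal_mult add.commute)
  finally have prob: "prob {\<omega> \<in> space M. \<exists>S\<in>set (Q \<omega>). bad H S} \<le> \<eta> * (L + 1)" (is "prob ?E \<le> _")
    using L \<eta> by (simp add: emeasure_eq_measure)
  let ?g = "hidden_cut U H (\<delta> * k)"
  \<comment> \<open>Integrability is checked for the nonnegative majorant only: a non-integrable
    left-hand side would have integral 0.\<close>
  have "(\<integral>\<omega>. ?g (result ?g (A \<omega>)) \<partial>M) \<le> (\<integral>\<omega>. (real k)\<^sup>2 * (1 + indicator ?E \<omega>) \<partial>M)"
  proof (rule integral_mono')
    show "integrable M (\<lambda>\<omega>. (real k)\<^sup>2 * (1 + indicator ?E \<omega>))"
      using sets by (intro integrable_mult_right Bochner_Integration.integrable_add)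
        (auto simp: emeasure_eq_measure)
    fix \<omega> assume \<omega>: "\<omega> \<in> space M"
    show "?g (result ?g (A \<omega>)) \<le> (real k)\<^sup>2 * (1 + indicator ?E \<omega>)"
    proof (cases "\<omega> \<in> ?E")
      case True
      then show ?thesis using hidden_cut_le[OF finU H(1)] H N \<delta> by (simp add: mult.commute)
    next
      case False
      then have agree: "?g S = ?f S" if "S \<in> set (Q \<omega>)" for S
        using that \<omega> by (auto simp: bad_def intro!: hidden_cut_eq_balanced_cut)
      then have "result ?g (A \<omega>) = result ?f (A \<omega>)"
        using strategy_indistinguishable[of ?f "A \<omega>" ?g] by (simp add: Q_def)
      then show ?thesis
        using False agree[of "result ?f (A \<omega>)"] balanced_cut_le[OF N(3)] by (simp add: Q_def)
    qed
  qed simp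
  also have "\<dots> = (real k)\<^sup>2 * (1 + prob ?E)"
    using sets by (simp add: prob_space emeasure_eq_measure)
  also have "\<dots> \<le> (real k)\<^sup>2 * (1 + \<eta> * (L + 1))"
    using prob by (intro mult_left_mono) auto
  finally show ?thesis using that H by (simp add: \<eta>_def)
qed

text \<open>Here m and d both equal k = \<open>card H\<close>, so the value is k^2 plus the square
  of \<open>(1 - \<delta>) * k\<close>; the bound drops the square of
  \<open>\<delta> * k\<close>.\<close>

lemma hidden_cut_optimum:
  assumes "finite U" "H \<subseteq> U" "card U = 2 * card H" "0 \<le> \<delta>" "\<delta> \<le> 1" "S \<inter> U = H"
  shows "(2 - 2 * \<delta>) * (real (card H))\<^sup>2 \<le> hidden_cut U H (\<delta> * card H) S"
proof -
  let ?k = "real (card H)"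
  have "S \<inter> H = H" "S \<inter> (U - H) = {}" using assms by auto
  then have "imbalance U H S = ?k" by (simp add: imbalance_def)
  moreover have "\<delta> * ?k \<le> 1 * ?k" using assms by (intro mult_right_mono) auto
  ultimately have "hidden_cut U H (\<delta> * card H) S = ?k\<^sup>2 + (?k - \<delta> * ?k)\<^sup>2"
    using assms by (simp add: hidden_cut_def dead_zone_sq_eq power2_eq_square)
  also have "\<dots> = (2 - 2 * \<delta>) * ?k\<^sup>2 + (\<delta> * ?k)\<^sup>2"
    by (simp add: power2_eq_square algebra_simps)
  finally show ?thesis by simp
qed

text \<open>For \<open>p / q \<le> 1 / 2\<close> the hidden half \<open>H\<close> itself is feasible; otherwise it is padded with the
  elements outside \<open>U\<close>.\<close>

lemma feasible_extension:
  assumes "finite N" "U \<subseteq> N" "H \<subseteq> U" "card U = 2 * card H" "p < q"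
    and k: "card H = min p (q - p) * r" and n: "card N = q * r"
  obtains S where "S \<in> card_eq_family p q N" "S \<inter> U = H"
proof -
  have fin: "finite U" "finite H"
    using assms finite_subset[of U N] finite_subset[of H U] by auto
  have fam: "S \<in> card_eq_family p q N" if "S \<subseteq> N" "card S = p * r" for S
    using that assms(5) n by (simp add: card_eq_family_def)
  show ?thesis
  proof (cases "p \<le> q - p")
    case True
    then show ?thesis using that[of H] fam[of H] assms by auto
  next
    case False
    have "card (H \<union> (N - U)) = card H + (card N - card U)"
      using assms fin by (subst card_Un_disjoint) (auto simp: card_Diff_subset)
    also have "\<dots> = p * r"
    proof -
      \<comment> \<open>In terms of \<open>d < p\<close>, the set \<open>H\<close> has
        \<open>d * r\<close> elements and \<open>N - U\<close> has \<open>(p - d) * r\<close>,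
        together \<open>p * r\<close>.\<close>
      obtain d where d: "q = p + d" using assms(5) less_imp_add_positive by blast
      then have "d * r \<le> p * r" using False by (intro mult_right_mono) auto
      then show ?thesis using False d assms(4) k n by (simp add: min_def algebra_simps)
    qed
    finally have "H \<union> (N - U) \<in> card_eq_family p q N" using fam assms by auto
    then show ?thesis using that[of "H \<union> (N - U)"] assms by auto
  qed
qed

section \<open>Choice of constants and the contradiction\<close>

theorem theorem1p4:
  fixes p q :: nat and \<epsilon> :: real
  assumes "0 < p" and "p < q" and "0 < \<epsilon>"
  shows "\<exists>c>0. \<exists>n0::nat. \<forall>(N :: 'a set) (M :: 'w measure) (A :: 'w \<Rightarrow> 'a strategy).
           finite N \<longrightarrow> card N \<ge> n0 \<longrightarrow> q dvd card N \<longrightarrow> oracle_algorithm N M A \<longrightarrow>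
           achieves_ratio (1/2 + \<epsilon>) N (card_eq_family p q N) M A \<or>
           achieves_ratio (1/2 + \<epsilon>) N (card_le_family p q N) M A \<longrightarrow>
           (\<exists>f. sym_submod N f \<and>
                expected_queries M A f \<ge> ennreal (exp (c * real (card N))))"
proof -
  \<comment> \<open>The product \<open>(1/2 + \<epsilon>) * (2 - 2 * \<delta>)\<close> equals
    \<open>1 + 2 * \<epsilon> - \<delta> - 2 * \<epsilon> * \<delta>\<close>; the two bounds on
    \<open>\<delta>\<close> keep it at least \<open>1 + \<epsilon> / 2\<close>.\<close>
  define \<delta> where "\<delta> = min (1/2) (\<epsilon> / 2)"
  have \<delta>: "0 < \<delta>" "\<delta> \<le> 1/2" "\<delta> \<le> \<epsilon> / 2" using assms by (auto simp: \<delta>_def)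
  \<comment> \<open>Since \<open>k\<close> will be at least \<open>card N / q\<close>, the rate
    \<open>\<delta>\<^sup>2 * k / 8\<close> is at least \<open>2 * c * card N\<close>: the failure
    probability per query beats \<open>exp (c * card N)\<close> queries and the linear
    factor.\<close>
  define c where "c = \<delta>\<^sup>2 / (16 * q)"
  have c: "0 < c" using \<delta> assms by (simp add: c_def)
  have "((\<lambda>n. 4 * real n * exp (- (2 * c * n)) * (exp (c * n) + 1)) \<longlongrightarrow> 0) sequentially"
    using c by real_asymp
  then have "\<forall>\<^sub>F n in sequentially. 4 * real n * exp (- (2 * c * n)) * (exp (c * n) + 1) < \<epsilon> / 2"
    by (rule order_tendstoD) (use assms in simp)
  then obtain n1 where n1:
    "\<And>n. n \<ge> n1 \<Longrightarrow> 4 * real n * exp (- (2 * c * n)) * (exp (c * n) + 1) < \<epsilon> / 2"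
    unfolding eventually_sequentially by blast
  \<comment> \<open>Any family \<open>\<F>\<close> between the equality family and
    \<open>Pow N\<close> is allowed, which covers both problems at once.\<close>
  have main: "\<exists>f. sym_submod N f \<and> ennreal (exp (c * real (card N))) \<le> expected_queries M A f"
    if N: "finite N" "max 1 n1 \<le> card N" "q dvd card N" and alg: "oracle_algorithm N M A"
      and ratio: "achieves_ratio (1/2 + \<epsilon>) N \<F> M A"
      and \<F>: "card_eq_family p q N \<subseteq> \<F>" "\<F> \<subseteq> Pow N"
    for N :: "'a set" and M :: "'w measure" and A \<F>
  proof (rule ccontr)
    assume contra: "\<not> ?thesis"
    obtain r where r: "card N = q * r" using N by (auto elim: dvdE)
    \<comment> \<open>This is the smaller of the target size and the size of its complement, so a
      set \<open>U\<close> of size \<open>2 * k\<close> fits into \<open>N\<close>.\<close>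
    define k where "k = min p (q - p) * r"
    have "0 < r" using N r by (cases r) auto
    then have k: "0 < k" using assms by (simp add: k_def)
    have "2 * min p (q - p) \<le> q" by linarith
    then have "2 * min p (q - p) * r \<le> q * r" by (rule mult_right_mono) simp
    then have k2: "2 * k \<le> card N" by (simp add: k_def r mult.assoc)
    then obtain U where U: "U \<subseteq> N" "card U = 2 * k"
      using obtain_subset_with_card_n by metis
    have finU: "finite U" using U N finite_subset by blast
    have "1 * r \<le> k" unfolding k_def using assms by (intro mult_right_mono) auto
    then have "real (card N) \<le> real q * k" using r by (simp add: mult_left_mono)
    then have rate: "2 * c * card N \<le> \<delta>\<^sup>2 * k / 8"
      using assms \<delta> by (simp add: c_def field_simps)
    \<comment> \<open>The denied query bound is used at \<open>balanced_cut U\<close>, before any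
      \<open>H\<close> is chosen; the ratio is later tested on the hidden cut instead.\<close>
    have "expected_queries M A (balanced_cut U) \<le> ennreal (exp (c * card N))"
      using contra sym_submod_balanced_cut[OF N(1) U] by (meson linear)
    then obtain H where H: "H \<subseteq> U" "card H = k" and int:
      "(\<integral>\<omega>. hidden_cut U H (\<delta> * k) (result (hidden_cut U H (\<delta> * k)) (A \<omega>)) \<partial>M)
       \<le> (real k)\<^sup>2 * (1 + 4 * real k * exp (- \<delta>\<^sup>2 * k / 8) * (exp (c * card N) + 1))"
      using exists_fooling_hidden_cut[OF N(1) U k _ _ alg, of \<delta> "exp (c * card N)"] \<delta> by auto
    let ?g = "hidden_cut U H (\<delta> * k)"
    have "4 * real k * exp (- \<delta>\<^sup>2 * k / 8) \<le> 4 * real (card N) * exp (- (2 * c * card N))"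
      using k2 rate by (intro mult_mono) auto
    then have "4 * real k * exp (- \<delta>\<^sup>2 * k / 8) * (exp (c * card N) + 1)
        \<le> 4 * real (card N) * exp (- (2 * c * card N)) * (exp (c * card N) + 1)"
      by (rule mult_right_mono) (auto intro: add_nonneg_nonneg)
    also have "\<dots> < \<epsilon> / 2" using n1 N by simp
    finally have upper: "(\<integral>\<omega>. ?g (result ?g (A \<omega>)) \<partial>M) < (real k)\<^sup>2 * (1 + \<epsilon> / 2)"
      using int k by (elim order_le_less_trans) (intro mult_strict_left_mono, auto)
    obtain S where S: "S \<in> card_eq_family p q N" "S \<inter> U = H"
      using feasible_extension[OF N(1) U(1) H(1) _ assms(2) _ r] H(2) U(2) by (auto simp: k_def)
    have "?g S \<le> Max (?g ` \<F>)"
      using S \<F> N by (intro Max_ge) (auto dest: finite_subset)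
    then have opt: "(2 - 2 * \<delta>) * (real k)\<^sup>2 \<le> Max (?g ` \<F>)"
      using hidden_cut_optimum[OF finU H(1) _ _ _ S(2), of \<delta>] U H \<delta> by simp
    have "sym_submod N ?g"
      using sym_submod_hidden_cut[OF N(1) U(1) H(1)] U H \<delta> by simp
    then have "(1/2 + \<epsilon>) * Max (?g ` \<F>) \<le> (\<integral>\<omega>. ?g (result ?g (A \<omega>)) \<partial>M)"
      using ratio by (simp add: achieves_ratio_def)
    moreover have "(1/2 + \<epsilon>) * ((2 - 2 * \<delta>) * (real k)\<^sup>2) \<le> (1/2 + \<epsilon>) * Max (?g ` \<F>)"
      using opt assms by (intro mult_left_mono) auto
    ultimately have "((1/2 + \<epsilon>) * (2 - 2 * \<delta>)) * (real k)\<^sup>2 < (1 + \<epsilon> / 2) * (real k)\<^sup>2"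
      using upper by (simp add: mult_ac)
    then have "(1/2 + \<epsilon>) * (2 - 2 * \<delta>) < 1 + \<epsilon> / 2"
      using k by simp
    moreover have "\<epsilon> * \<delta> \<le> \<epsilon> * (1/2)" using \<delta> assms by (intro mult_left_mono) auto
    moreover have "(1/2 + \<epsilon>) * (2 - 2 * \<delta>) = 1 + 2 * \<epsilon> - \<delta> - 2 * (\<epsilon> * \<delta>)"
      by (simp add: algebra_simps)
    ultimately show False using \<delta> by linarith
  qed
  have families: "card_eq_family p q N \<subseteq> card_le_family p q N" "card_eq_family p q N \<subseteq> Pow N"
    "card_le_family p q N \<subseteq> Pow N" for N :: "'a set"
    by (auto simp: card_eq_family_def card_le_family_def)
  show ?thesis
    using c main[OF _ _ _ _ _ subset_refl families(2)] main[OF _ _ _ _ _ families(1,3)]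
    by (intro exI[of _ c] conjI exI[of _ "max 1 n1"] allI impI) (assumption, elim disjE)
qed

end
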